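(* Let $\mu_1\ge\mu_2>0$, $A\in\mathbb{R}^{m\times n}$, $b\in\mathbb{R}^m$, and let $H_1,H_2$ be proper closed convex functions on $\mathbb{R}^n$ for which there exists a norm $\rho$ on $\mathbb{R}^n$ with $0\le H_2(z)\le\min\{\rho(z),H_1(z)\}$ for all $z$. Suppose that the function $$J(z):=\frac12\|Az-b\|^2+\mu_1H_1(z)-\mu_2H_2(z)$$ is coercive. For $(y,z)\in\mathbb{R}^n\times\mathbb{R}^n$ let $$f(y,z):=\frac12\|Az-b\|^2-\mu_2\langle y,z\rangle,\qquad P(y,z):=\mu_1H_1(z)+\mu_2H_2^*(y).$$ Then $f+P$ is coercive. Consequently, if $L>0$ is such that all eigenvalues of the (constant) Hessian $\nabla^2 f$ lie in $[-L,L]$, then for any $\gamma\in(0,\frac1L)$ the forward-backward envelope $F_\gamma$ of $f+P$ is level bounded.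
   Context: Norms $\|\cdot\|$ are Euclidean. $H_2^*(y):=\sup_z\{\langle y,z\rangle-H_2(z)\}$ is the convex conjugate. With $x=(y,z)$, the forward-backward envelope is $F_\gamma(x):=\inf_{w}\{f(x)+\langle\nabla f(x),w-x\rangle+\frac{1}{2\gamma}\|w-x\|^2+P(w)\}$. A proper closed function $g$ is level bounded if $\{x:g(x)\le r\}$ is bounded for every $r\in\mathbb{R}$, and is coercive if $\liminf_{\|x\|\to\infty}g(x)/\|x\|>0$. *)

theory Defs
  imports "HOL-Analysis.Analysis"
begin

text \<open>Extended-real-valued convex analysis on a Euclidean space.\<close>

definition proper :: "('a \<Rightarrow> ereal) \<Rightarrow> bool" where
  "proper g \<longleftrightarrow> (\<forall>x. g x \<noteq> -\<infinity>) \<and> (\<exists>x. g x \<noteq> \<infinity>)"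

text \<open>The library's \<^const>\<open>epigraph\<close> is for real-valued functions only.\<close>

definition epi :: "('a \<Rightarrow> ereal) \<Rightarrow> ('a \<times> real) set" where
  "epi g = {(x, r). g x \<le> ereal r}"

definition proper_closed_convex :: "('a::euclidean_space \<Rightarrow> ereal) \<Rightarrow> bool" where
  "proper_closed_convex g \<longleftrightarrow> proper g \<and> closed (epi g) \<and> convex (epi g)"

definition is_norm :: "('a::real_vector \<Rightarrow> real) \<Rightarrow> bool" where
  "is_norm \<rho> \<longleftrightarrow>
     (\<forall>x. 0 \<le> \<rho> x) \<and> (\<forall>x. \<rho> x = 0 \<longleftrightarrow> x = 0) \<and>
     (\<forall>c x. \<rho> (c *\<^sub>R x) = \<bar>c\<bar> * \<rho> x) \<and> (\<forall>x y. \<rho> (x + y) \<le> \<rho> x + \<rho> y)"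

definition convex_conjugate :: "('a::real_inner \<Rightarrow> ereal) \<Rightarrow> 'a \<Rightarrow> ereal" where
  "convex_conjugate g y = (SUP z. ereal (y \<bullet> z) - g z)"

definition coercive :: "('a::real_normed_vector \<Rightarrow> ereal) \<Rightarrow> bool" where
  "coercive g \<longleftrightarrow> Liminf at_infinity (\<lambda>x. g x / ereal (norm x)) > 0"

definition level_bounded :: "('a::real_normed_vector \<Rightarrow> ereal) \<Rightarrow> bool" where
  "level_bounded g \<longleftrightarrow> (\<forall>r::real. bounded {x. g x \<le> ereal r})"

text \<open>\<open>gradient\<close> and \<open>hessian\<close> are meaningful only where the derivatives exist; \<open>hessian f x\<close>
  is the Hessian as the linear operator \<open>v \<mapsto> \<nabla>\<^sup>2f(x) v\<close>.\<close>

definition gradient :: "('a::real_inner \<Rightarrow> real) \<Rightarrow> 'a \<Rightarrow> 'a" where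
  "gradient f x = (THE D. GDERIV f x :> D)"

definition hessian :: "('a::real_inner \<Rightarrow> real) \<Rightarrow> 'a \<Rightarrow> 'a \<Rightarrow> 'a" where
  "hessian f x = frechet_derivative (gradient f) (at x)"

definition eigenvalue_of :: "('a::real_vector \<Rightarrow> 'a) \<Rightarrow> real \<Rightarrow> bool" where
  "eigenvalue_of T \<kappa> \<longleftrightarrow> (\<exists>v. v \<noteq> 0 \<and> T v = \<kappa> *\<^sub>R v)"

text \<open>The forward-backward envelope of \<open>f + P\<close> depends on the splitting into \<open>f\<close> and \<open>P\<close>.\<close>

definition fb_envelope ::
    "real \<Rightarrow> ('a::real_inner \<Rightarrow> real) \<Rightarrow> ('a \<Rightarrow> ereal) \<Rightarrow> 'a \<Rightarrow> ereal" where
  "fb_envelope \<gamma> f P x =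
     (INF w. ereal (f x + gradient f x \<bullet> (w - x) + (1 / (2 * \<gamma>)) * (norm (w - x))\<^sup>2) + P w)"

end

theory Submission
  imports Defs
begin

text \<open>Since \<open>H\<^sub>2\<close> is dominated by a norm, \<open>H\<^sub>2\<^sup>*\<close> is infinite outside some ball, and by Fenchel--Young
  \<open>f(y,z) + P(y,z) \<ge> J(z) \<ge> 0\<close>; hence coercivity of \<open>J\<close> in \<open>z\<close> passes to \<open>f + P\<close> in \<open>(y,z)\<close>.
  As \<open>f\<close> is quadratic with Hessian at most \<open>L\<close>, the function minimized in the envelope dominates
  \<open>f(w) + P(w) + (1/\<gamma> - L)/2 \<cdot> \<parallel>w - x\<parallel>\<^sup>2\<close>, so if \<open>F\<^sub>\<gamma>(x) \<le> r\<close> then \<open>x\<close> is at bounded distance from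
  a point \<open>w\<close> of a bounded sublevel set of \<open>f + P\<close>.\<close>

text \<open>A maximizer of the Rayleigh quotient on the compact unit sphere is an eigenvector, so
  the maximum is itself an eigenvalue and hence at most \<open>L\<close>.\<close>

lemma selfadjoint_le_if_eigenvalues_le:
  fixes T :: "'a::euclidean_space \<Rightarrow> 'a"
  assumes lin: "linear T" and sym: "\<And>x y. x \<bullet> T y = T x \<bullet> y"
    and ev: "\<And>\<kappa>. eigenvalue_of T \<kappa> \<Longrightarrow> \<kappa> \<le> L"
  shows "x \<bullet> T x \<le> L * (norm x)\<^sup>2"
proof -
  have "continuous_on (sphere 0 1) (\<lambda>x. x \<bullet> T x)"
    using lin by (intro continuous_intros linear_continuous_on linear_conv_bounded_linear[THEN iffD1])
  moreover obtain e :: 'a where "e \<in> Basis" using nonempty_Basis by blast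
  then have "sphere (0::'a) 1 \<noteq> {}" by force
  ultimately obtain v where v: "norm v = 1" and max: "\<And>u. norm u = 1 \<Longrightarrow> u \<bullet> T u \<le> v \<bullet> T v"
    using continuous_attains_sup[of "sphere (0::'a) 1" "\<lambda>x. x \<bullet> T x"] by auto
  define \<kappa> where "\<kappa> = v \<bullet> T v"
  have le: "u \<bullet> T u \<le> \<kappa> * (norm u)\<^sup>2" for u
  proof (cases "u = 0")
    case False
    have "(u /\<^sub>R norm u) \<bullet> T (u /\<^sub>R norm u) \<le> \<kappa>"
      unfolding \<kappa>_def by (rule max) (use False in simp)
    then show ?thesis
      using False by (simp add: linear_scale[OF lin] field_simps power2_eq_square)
  qed (simp add: linear_0[OF lin])
  \<comment> \<open>The form \<open>\<kappa> \<parallel>u\<parallel>\<^sup>2 - \<langle>u, T u\<rangle>\<close> is nonnegative and vanishes at \<open>v\<close>, hence so does its gradient there.\<close>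
  define d where "d = T v - \<kappa> *\<^sub>R v"
  have "d \<bullet> d = 0"
  proof (rule ccontr)
    assume "d \<bullet> d \<noteq> 0"
    then have pos: "d \<bullet> d > 0" by simp
    \<comment> \<open>Perturb \<open>v\<close> along \<open>d\<close>. \<open>B\<close> dominates
      the second-order coefficient, and the summand 1 makes it positive. The step \<open>t\<close>
      gives \<open>t * B = d \<bullet> d\<close>, too small to balance the first-order gain
      \<open>2 * (d \<bullet> d)\<close>.\<close>
    define B where "B = \<bar>\<kappa> * (d \<bullet> d) - d \<bullet> T d\<bar> + 1"
    define t where "t = (d \<bullet> d) / B"
    have B: "B > 0" by (simp add: B_def)
    have t: "t > 0" using pos B by (simp add: t_def)
    have 1: "(v + t *\<^sub>R d) \<bullet> T (v + t *\<^sub>R d) \<le> \<kappa> * ((v + t *\<^sub>R d) \<bullet> (v + t *\<^sub>R d))"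
      using le by (simp add: power2_norm_eq_inner)
    have 2: "(v + t *\<^sub>R d) \<bullet> T (v + t *\<^sub>R d) = \<kappa> + 2 * t * (d \<bullet> T v) + t\<^sup>2 * (d \<bullet> T d)"
      using sym[of v d] by (simp add: linear_add[OF lin] linear_scale[OF lin] inner_simps
          inner_commute \<kappa>_def algebra_simps power2_eq_square)
    have 3: "(v + t *\<^sub>R d) \<bullet> (v + t *\<^sub>R d) = 1 + 2 * t * (d \<bullet> v) + t\<^sup>2 * (d \<bullet> d)"
      using v by (simp add: inner_simps inner_commute algebra_simps power2_eq_square
          norm_eq_1)
    have 4: "d \<bullet> T v = d \<bullet> d + \<kappa> * (d \<bullet> v)"
      by (simp add: d_def inner_simps)
    have "t * (2 * (d \<bullet> d)) \<le> t * (t * (\<kappa> * (d \<bullet> d) - d \<bullet> T d))"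
      using 1 unfolding 2 3 4 by (simp add: algebra_simps power2_eq_square)
    then have "2 * (d \<bullet> d) \<le> t * (\<kappa> * (d \<bullet> d) - d \<bullet> T d)" using t by simp
    also have "\<dots> \<le> t * B" using t by (simp add: B_def)
    also have "\<dots> = d \<bullet> d" using B by (simp add: t_def)
    finally show False using pos by simp
  qed
  then have "T v = \<kappa> *\<^sub>R v" by (simp add: d_def)
  then have "\<kappa> \<le> L" using v by (intro ev, unfold eigenvalue_of_def, intro exI[of _ v]) auto
  with le[of x] show ?thesis
    by (meson mult_right_mono order_trans zero_le_power2)
qed

text \<open>Apply the triangle inequality to the basis expansion of \<open>z\<close>;
  \<open>C\<close> is the sum of the values of \<open>\<rho>\<close> on the basis.\<close>

lemma is_norm_le_mult_norm:
  fixes \<rho> :: "'a::euclidean_space \<Rightarrow> real"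
  assumes "is_norm \<rho>"
  obtains C where "\<And>z. \<rho> z \<le> C * norm z"
proof
  fix z :: 'a
  have zero: "\<rho> 0 = 0" and add: "\<And>x y. \<rho> (x + y) \<le> \<rho> x + \<rho> y"
    and scale: "\<And>c x. \<rho> (c *\<^sub>R x) = \<bar>c\<bar> * \<rho> x" and nn: "\<And>x. 0 \<le> \<rho> x"
    using assms by (auto simp: is_norm_def)
  have sum_le: "\<rho> (sum g S) \<le> (\<Sum>i\<in>S. \<rho> (g i))" if "finite S" for g :: "'a \<Rightarrow> 'a" and S
    using that
  proof induction
    case (insert i S)
    then show ?case using add[of "g i" "sum g S"] by simp
  qed (simp add: zero)
  have "\<rho> z = \<rho> (\<Sum>e\<in>Basis. (z \<bullet> e) *\<^sub>R e)" by (simp add: euclidean_representation)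
  also have "\<dots> \<le> (\<Sum>e\<in>Basis. \<rho> ((z \<bullet> e) *\<^sub>R e))" by (rule sum_le) simp
  also have "\<dots> \<le> (\<Sum>e\<in>Basis. \<rho> e * norm z)"
    by (intro sum_mono) (simp add: scale nn Basis_le_norm mult.commute[of "\<rho> _"] mult_right_mono)
  finally show "\<rho> z \<le> (\<Sum>e\<in>Basis. \<rho> e) * norm z" by (simp add: sum_distrib_right)
qed

lemma fenchel_young: "ereal (y \<bullet> z) - H z \<le> convex_conjugate H y"
  unfolding convex_conjugate_def by (rule SUP_upper) simp

text \<open>Along the ray through \<open>y\<close> the supremum is bounded below by a linear
  function of slope \<open>k\<close>. As \<open>C\<close> may be negative,
  \<open>y \<noteq> 0\<close> is what makes the factor \<open>norm y\<close> of \<open>k\<close>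
  positive.\<close>

lemma convex_conjugate_eq_infinity:
  fixes H :: "'a::real_inner \<Rightarrow> ereal"
  assumes H: "\<And>z. H z \<le> ereal (C * norm z)" and y: "norm y > C" "y \<noteq> 0"
  shows "convex_conjugate H y = \<infinity>"
proof (rule ereal_top)
  fix r :: real
  define k where "k = norm y * (norm y - C)"
  have k: "k > 0" using y by (simp add: k_def)
  define t where "t = \<bar>r\<bar> / k"
  have t: "t \<ge> 0" using k by (simp add: t_def)
  have "y \<bullet> (t *\<^sub>R y) - C * norm (t *\<^sub>R y) = t * k"
    using t by (simp add: k_def power2_norm_eq_inner[symmetric] power2_eq_square algebra_simps)
  also have "\<dots> = \<bar>r\<bar>" using k by (simp add: t_def)
  finally have "ereal r \<le> ereal (y \<bullet> (t *\<^sub>R y)) - ereal (C * norm (t *\<^sub>R y))" by simp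
  also have "\<dots> \<le> ereal (y \<bullet> (t *\<^sub>R y)) - H (t *\<^sub>R y)"
    by (intro ereal_minus_mono H order_refl)
  also have "\<dots> \<le> convex_conjugate H y" by (rule fenchel_young)
  finally show "ereal r \<le> convex_conjugate H y" .
qed

lemma coercive_iff_linear_growth:
  fixes g :: "'a::real_normed_vector \<Rightarrow> ereal"
  shows "coercive g \<longleftrightarrow> (\<exists>c>0. \<exists>R. \<forall>x. R \<le> norm x \<longrightarrow> ereal (c * norm x) \<le> g x)"
proof
  assume "coercive g"
  then obtain c where c: "0 < ereal c" "ereal c < Liminf at_infinity (\<lambda>x. g x / ereal (norm x))"
    unfolding coercive_def using ereal_dense2 by blast
  then obtain R where R: "\<And>x. R \<le> norm x \<Longrightarrow> ereal c < g x / ereal (norm x)"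
    using less_LiminfD[OF c(2)] by (auto simp: eventually_at_infinity)
  \<comment> \<open>The 1 in \<open>max R 1\<close> keeps \<open>norm x\<close> positive, so that
    the quotient can be multiplied out.\<close>
  have "ereal (c * norm x) \<le> g x" if "max R 1 \<le> norm x" for x
  proof -
    have pos: "0 < norm x" using that by linarith
    have "ereal c \<le> g x / ereal (norm x)" using R[of x] that by simp
    then show ?thesis using pos by (simp add: ereal_le_divide_pos mult.commute)
  qed
  then show "\<exists>c>0. \<exists>R. \<forall>x. R \<le> norm x \<longrightarrow> ereal (c * norm x) \<le> g x" using c by (intro exI[of _ c] conjI exI[of _ "max R 1"]) auto
next
  assume "\<exists>c>0. \<exists>R. \<forall>x. R \<le> norm x \<longrightarrow> ereal (c * norm x) \<le> g x"
  then obtain c R where c: "c > 0" and R: "\<And>x. R \<le> norm x \<Longrightarrow> ereal (c * norm x) \<le> g x" by blast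
  have "ereal c \<le> g x / ereal (norm x)" if "max R 1 \<le> norm x" for x
  proof -
    have pos: "0 < norm x" using that by linarith
    then show ?thesis using R[of x] that by (simp add: ereal_le_divide_pos mult.commute)
  qed
  then have "\<forall>\<^sub>F x in at_infinity. ereal c \<le> g x / ereal (norm x)"
    unfolding eventually_at_infinity by blast
  then have "ereal c \<le> Liminf at_infinity (\<lambda>x. g x / ereal (norm x))" by (rule Liminf_bounded)
  then show "coercive g" unfolding coercive_def using c by (meson ereal_less(2) less_le_trans)
qed

lemma coercive_imp_level_bounded:
  assumes "coercive g"
  shows "level_bounded g"
  unfolding level_bounded_def
proof
  fix r
  obtain c R where c: "c > 0" and R: "\<And>x. R \<le> norm x \<Longrightarrow> ereal (c * norm x) \<le> g x"
    using assms by (auto simp: coercive_iff_linear_growth)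
  have "norm x \<le> max R (r / c)" if "g x \<le> ereal r" for x
  proof (cases "R \<le> norm x")
    case True
    then have "ereal (c * norm x) \<le> ereal r" using R that order_trans by blast
    then have "norm x \<le> r / c" using c by (simp add: field_simps)
    then show ?thesis by simp
  qed simp
  then show "bounded {x. g x \<le> ereal r}" unfolding bounded_iff by blast
qed

lemma level_bounded_fb_envelope:
  assumes descent: "\<And>x w. f w \<le> f x + gradient f x \<bullet> (w - x) + L / 2 * (norm (w - x))\<^sup>2"
    and below: "\<And>w. ereal m \<le> ereal (f w) + P w"
    and lev: "level_bounded (\<lambda>x. ereal (f x) + P x)"
    and \<gamma>: "\<gamma> > 0" "L * \<gamma> < 1"
  shows "level_bounded (fb_envelope \<gamma> f P)"
  unfolding level_bounded_def
proof
  fix r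
  \<comment> \<open>The infimum in the envelope need not be attained; the level \<open>r + 1\<close>
    leaves room for a near-minimizer \<open>w\<close>.\<close>
  obtain M where M: "\<And>w. ereal (f w) + P w \<le> ereal (r + 1) \<Longrightarrow> norm w \<le> M"
    using lev unfolding level_bounded_def bounded_iff by blast
  \<comment> \<open>What remains of the proximal coefficient after the descent inequality has used
    up \<open>L / 2\<close>.\<close>
  define \<delta> where "\<delta> = 1 / (2 * \<gamma>) - L / 2"
  have \<delta>: "\<delta> > 0" using \<gamma> by (simp add: \<delta>_def field_simps)
  have "norm x \<le> M + sqrt ((r + 1 - m) / \<delta>)" if "fb_envelope \<gamma> f P x \<le> ereal r" for x
  proof -
    have "fb_envelope \<gamma> f P x < ereal (r + 1)" using that by (simp add: le_less_trans)
    then obtain w where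
      w: "ereal (f x + gradient f x \<bullet> (w - x) + (1 / (2 * \<gamma>)) * (norm (w - x))\<^sup>2) + P w < ereal (r + 1)"
      unfolding fb_envelope_def INF_less_iff by blast
    have "ereal (f w + \<delta> * (norm (w - x))\<^sup>2) + P w
        \<le> ereal (f x + gradient f x \<bullet> (w - x) + (1 / (2 * \<gamma>)) * (norm (w - x))\<^sup>2) + P w"
      using descent[of w x] by (intro add_right_mono) (simp add: \<delta>_def algebra_simps)
    also note w
    finally have le: "ereal (f w + \<delta> * (norm (w - x))\<^sup>2) + P w < ereal (r + 1)" .
    with below[of w] obtain p where p: "P w = ereal p" by (cases "P w") auto
    have nn: "0 \<le> \<delta> * (norm (w - x))\<^sup>2" using \<delta> by simp
    have lep: "f w + \<delta> * (norm (w - x))\<^sup>2 + p < r + 1" using le p by simp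
    \<comment> \<open>The bound is used twice: dropping the \<open>\<delta>\<close> term bounds
      \<open>w\<close>, while replacing \<open>f w + p\<close> by its lower bound \<open>m\<close>
      bounds the distance from \<open>w\<close> to \<open>x\<close>.\<close>
    then have "norm w \<le> M" using nn p by (intro M) simp
    moreover have "\<delta> * (norm (w - x))\<^sup>2 \<le> r + 1 - m" using lep below[of w] p by simp
    then have "norm (w - x) \<le> sqrt ((r + 1 - m) / \<delta>)"
      using \<delta> by (intro real_le_rsqrt) (simp add: field_simps)
    moreover have "norm x \<le> norm w + norm (w - x)" using norm_triangle_ineq4[of w "w - x"] by simp
    ultimately show ?thesis by linarith
  qed
  then show "bounded {x. fb_envelope \<gamma> f P x \<le> ereal r}" unfolding bounded_iff by blast
qed

lemma gradient_eqI: "GDERIV f x :> D \<Longrightarrow> gradient f x = D"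
  unfolding gradient_def
proof (rule the_equality)
  fix D' assume "GDERIV f x :> D" "GDERIV f x :> D'"
  then have "(\<lambda>h. h \<bullet> D') = (\<lambda>h. h \<bullet> D)" unfolding gderiv_def by (metis has_derivative_unique)
  then show "D' = D" by (metis vector_eq_ldot)
qed

text \<open>The second-order expansion is exact with a constant operator \<open>T\<close>, so
  \<open>T\<close> is the Hessian everywhere and its eigenvalues at 0 control the remainder.\<close>

lemma quadratic_descent:
  fixes f :: "'a::euclidean_space \<Rightarrow> real"
  assumes lin: "linear T" and sym: "\<And>x y. x \<bullet> T y = T x \<bullet> y"
    and f: "\<And>x h. f (x + h) = f x + (T x + c) \<bullet> h + 1 / 2 * (h \<bullet> T h)"
    and ev: "\<And>\<kappa>. eigenvalue_of (hessian f 0) \<kappa> \<Longrightarrow> \<kappa> \<le> L"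
  shows "f w \<le> f x + gradient f x \<bullet> (w - x) + L / 2 * (norm (w - x))\<^sup>2"
proof -
  have bl: "bounded_linear T" using lin by (simp add: linear_conv_bounded_linear)
  have T: "(T has_derivative T) F" for F
    using bl by (rule bounded_linear_imp_has_derivative)
  have fq: "f = (\<lambda>u. f 0 + c \<bullet> u + 1 / 2 * (u \<bullet> T u))"
  proof
    show "f u = f 0 + c \<bullet> u + 1 / 2 * (u \<bullet> T u)" for u
      using f[of 0 u] by (simp only: add_0_left linear_0[OF lin])
  qed
  have "GDERIV f u :> T u + c" for u
  proof -
    have "((\<lambda>u. k + c \<bullet> u + 1 / 2 * (u \<bullet> T u)) has_derivative
        (\<lambda>h. 0 + c \<bullet> h + 1 / 2 * (u \<bullet> T h + h \<bullet> T u))) (at u)" for k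
      by (rule derivative_intros T)+
    moreover have "0 + c \<bullet> h + 1 / 2 * (u \<bullet> T h + h \<bullet> T u) = h \<bullet> (T u + c)" for h
      by (simp add: sym[of u h] inner_add_right inner_commute[of c] inner_commute[of "T u"])
    ultimately show ?thesis unfolding gderiv_def by (subst fq) simp
  qed
  then have grad: "gradient f = (\<lambda>u. T u + c)" by (intro ext gradient_eqI)
  have "((\<lambda>u. T u + c) has_derivative T) (at 0)"
    by (auto intro!: derivative_eq_intros T)
  then have "hessian f 0 = T"
    unfolding hessian_def grad by (rule frechet_derivative_at[symmetric])
  then have "(w - x) \<bullet> T (w - x) \<le> L * (norm (w - x))\<^sup>2"
    using ev by (intro selfadjoint_le_if_eigenvalues_le lin sym) simp
  then show ?thesis using f[of x "w - x"] grad by simp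
qed

lemma coercive_fst_bounded:
  fixes g :: "'a::real_normed_vector \<times> 'b::real_normed_vector \<Rightarrow> ereal"
  assumes "coercive J" and le: "\<And>y z. J z \<le> g (y, z)"
    and inf: "\<And>y z. norm y > C \<Longrightarrow> g (y, z) = \<infinity>"
  shows "coercive g"
proof -
  obtain c R where c: "c > 0" and R: "\<And>z. R \<le> norm z \<Longrightarrow> ereal (c * norm z) \<le> J z"
    using assms(1) by (auto simp: coercive_iff_linear_growth)
  \<comment> \<open>When the first component has norm at most \<open>C\<close>, the threshold
    \<open>R + C\<close> makes the second one at least \<open>R\<close>, and \<open>2 * C\<close>
    makes it at least half of \<open>norm x\<close>; this is why \<open>c\<close> is halved.\<close>
  have "ereal (c / 2 * norm x) \<le> g x" if x: "max (R + C) (2 * C) \<le> norm x" for x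
  proof (cases "norm (fst x) > C")
    case True
    then show ?thesis using inf[of "fst x" "snd x"] by simp
  next
    case False
    have "norm x \<le> norm (fst x) + norm (snd x)"
      using norm_Pair_le[of "fst x" "snd x"] by simp
    with False x have "R \<le> norm (snd x)" and half: "norm x / 2 \<le> norm (snd x)" by auto
    then have "ereal (c * norm (snd x)) \<le> g x"
      using R[of "snd x"] le[of "snd x" "fst x"] by (metis order_trans prod.collapse)
    moreover have "c / 2 * norm x \<le> c * norm (snd x)" using half c by (simp add: field_simps)
    ultimately show ?thesis by (meson ereal_less_eq(3) order_trans)
  qed
  moreover have "c / 2 > 0" using c by simp
  ultimately show ?thesis unfolding coercive_iff_linear_growth by blast
qed

theorem proposition4p1:
  fixes \<mu>\<^sub>1 \<mu>\<^sub>2 :: real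
    and A :: "real ^ 'n ^ 'm" and b :: "real ^ 'm"
    and H\<^sub>1 H\<^sub>2 J :: "real ^ 'n \<Rightarrow> ereal"
    and f :: "(real ^ 'n) \<times> (real ^ 'n) \<Rightarrow> real"
    and P :: "(real ^ 'n) \<times> (real ^ 'n) \<Rightarrow> ereal"
  assumes "\<mu>\<^sub>1 \<ge> \<mu>\<^sub>2" and "\<mu>\<^sub>2 > 0"
    and "proper_closed_convex H\<^sub>1" and "proper_closed_convex H\<^sub>2"
    and "\<exists>\<rho>. is_norm \<rho> \<and> (\<forall>z. 0 \<le> H\<^sub>2 z \<and> H\<^sub>2 z \<le> min (ereal (\<rho> z)) (H\<^sub>1 z))"
    and J: "\<And>z. J z = ereal (1 / 2 * (norm (A *v z - b))\<^sup>2) + ereal \<mu>\<^sub>1 * H\<^sub>1 z - ereal \<mu>\<^sub>2 * H\<^sub>2 z"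
    and "coercive J"
    and f: "\<And>y z. f (y, z) = 1 / 2 * (norm (A *v z - b))\<^sup>2 - \<mu>\<^sub>2 * (y \<bullet> z)"
    and P: "\<And>y z. P (y, z) = ereal \<mu>\<^sub>1 * H\<^sub>1 z + ereal \<mu>\<^sub>2 * convex_conjugate H\<^sub>2 y"
  shows "coercive (\<lambda>x. ereal (f x) + P x) \<and>
    (\<forall>L>0. (\<forall>x \<kappa>. eigenvalue_of (hessian f x) \<kappa> \<longrightarrow> \<kappa> \<in> {-L..L}) \<longrightarrow>
       (\<forall>\<gamma>\<in>{0<..<1 / L}. level_bounded (fb_envelope \<gamma> f P)))"
proof -
  obtain \<rho> where \<rho>: "is_norm \<rho>" and H2: "\<And>z. 0 \<le> H\<^sub>2 z" "\<And>z. H\<^sub>2 z \<le> ereal (\<rho> z)" "\<And>z. H\<^sub>2 z \<le> H\<^sub>1 z"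
    using assms(5) by auto
  obtain C where "\<And>z. \<rho> z \<le> C * norm z" using is_norm_le_mult_norm[OF \<rho>] by blast
  then have H2C: "H\<^sub>2 z \<le> ereal (C * norm z)" for z
    using H2(2) by (meson ereal_less_eq(3) order_trans)
  \<comment> \<open>Test with \<open>z = 0\<close>, where the two bounds force the value of
    \<open>H\<^sub>2\<close> to be 0.\<close>
  have conj: "0 \<le> convex_conjugate H\<^sub>2 y" for y
    using fenchel_young[of y 0 H\<^sub>2] H2(1)[of 0] H2C[of 0] by (simp add: zero_ereal_def)
  let ?G = "\<lambda>x. ereal (f x) + P x"
  have J_nonneg: "0 \<le> J z" and J_le: "J z \<le> ?G (y, z)" for y z
  proof -
    obtain h where h: "H\<^sub>2 z = ereal h" using H2(1,2)[of z] by (cases "H\<^sub>2 z") auto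
    have h0: "h \<ge> 0" using H2(1)[of z] h by simp
    have fy: "ereal (y \<bullet> z - h) \<le> convex_conjugate H\<^sub>2 y" using fenchel_young[of y z H\<^sub>2] h by simp
    have "0 \<le> J z \<and> J z \<le> ?G (y, z)"
    proof (cases "H\<^sub>1 z")
      case (real k)
      then have k: "h \<le> k" using H2(3)[of z] h by simp
      then have "\<mu>\<^sub>2 * h \<le> \<mu>\<^sub>1 * k" using assms(1,2) h0 by (intro mult_mono) auto
      then have "0 \<le> J z" by (simp add: J real h add_increasing)
      moreover have "J z \<le> ?G (y, z)"
      proof (cases "convex_conjugate H\<^sub>2 y")
        case (real s)
        \<comment> \<open>Scaled Fenchel-Young: trading \<open>- \<mu>\<^sub>2 * h\<close> for
          \<open>\<mu>\<^sub>2 * s - \<mu>\<^sub>2 * (y \<bullet> z)\<close> turns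
          \<open>J z\<close> into the value of \<open>f + P\<close>.\<close>
        then have "\<mu>\<^sub>2 * (y \<bullet> z - h) \<le> \<mu>\<^sub>2 * s" using fy assms(2) by simp
        then show ?thesis using \<open>H\<^sub>1 z = ereal k\<close> real by (simp add: J f P h algebra_simps)
      qed (use conj[of y] \<open>\<mu>\<^sub>2 > 0\<close> in \<open>auto simp: P\<close>)
      ultimately show ?thesis ..
    next
      case PInf
      \<comment> \<open>Both sides are infinite here: \<open>H\<^sub>2 z\<close> is finite and the
        conjugate is not minus infinity, so nothing cancels.\<close>
      have "ereal \<mu>\<^sub>1 * \<infinity> = \<infinity>" using assms(1,2) by simp
      moreover have "ereal \<mu>\<^sub>2 * convex_conjugate H\<^sub>2 y \<noteq> -\<infinity>"
        using conj[of y] assms(2) by (cases "convex_conjugate H\<^sub>2 y") auto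
      ultimately show ?thesis using PInf by (simp add: J P h)
    qed (use H2(3)[of z] h in auto)
    then show "0 \<le> J z" "J z \<le> ?G (y, z)" by auto
  qed
  \<comment> \<open>The sign of \<open>C\<close> is unknown; \<open>max C 0\<close> also yields
    \<open>y \<noteq> 0\<close>.\<close>
  have G_inf: "?G (y, z) = \<infinity>" if "norm y > max C 0" for y z
  proof -
    have "convex_conjugate H\<^sub>2 y = \<infinity>" using that by (intro convex_conjugate_eq_infinity[OF H2C]) auto
    moreover have "ereal \<mu>\<^sub>1 * H\<^sub>1 z \<noteq> -\<infinity>"
      using H2(1,3)[of z] assms(1,2) by (cases "H\<^sub>1 z") auto
    ultimately show ?thesis using assms(2) by (simp add: P)
  qed
  have coer: "coercive ?G" using assms(7) J_le G_inf by (rule coercive_fst_bounded)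
  have "level_bounded (fb_envelope \<gamma> f P)"
    if "L > 0" and ev: "\<And>x \<kappa>. eigenvalue_of (hessian f x) \<kappa> \<Longrightarrow> \<kappa> \<in> {-L..L}"
      and \<gamma>: "\<gamma> \<in> {0<..<1 / L}" for L \<gamma>
  proof (rule level_bounded_fb_envelope)
    \<comment> \<open>The Hessian in block form: zero and \<open>- \<mu>\<^sub>2\<close> times the
      identity in the first row, \<open>- \<mu>\<^sub>2\<close> times the identity and A^T A in the
      second. Here \<open>v* A\<close> acts as the transpose of \<open>A\<close>.\<close>
    define T :: "(real ^ 'n) \<times> (real ^ 'n) \<Rightarrow> (real ^ 'n) \<times> (real ^ 'n)" where
      "T = (\<lambda>u. (- \<mu>\<^sub>2 *\<^sub>R snd u, (A *v snd u) v* A - \<mu>\<^sub>2 *\<^sub>R fst u))"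
    have "linear T"
      by (rule linearI) (auto simp: T_def matrix_vector_right_distrib vector_matrix_left_distrib
          matrix_vector_mult_scaleR scaleR_vector_matrix_assoc algebra_simps)
    moreover have "u \<bullet> T v = T u \<bullet> v" for u v
      using dot_lmul_matrix[of "A *v snd u" A "snd v"] dot_lmul_matrix[of "A *v snd v" A "snd u"]
      by (simp add: T_def inner_prod_def inner_diff_left inner_diff_right inner_commute)
    moreover have "f (u + h) = f u + (T u + (0, - (b v* A))) \<bullet> h + 1 / 2 * (h \<bullet> T h)" for u h
    proof -
      \<comment> \<open>With \<open>a\<close> and \<open>d\<close> the images under \<open>A\<close>
        of the point and the increment, the cross terms give the gradient and
        \<open>d \<bullet> d\<close> the A^T A part of the quadratic term.\<close>
      have *: "(a - b + d) \<bullet> (a - b + d) = (a - b) \<bullet> (a - b) + 2 * (a \<bullet> d) - 2 * (b \<bullet> d) + d \<bullet> d" for a d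
        by (simp add: inner_simps inner_commute)
      have "A *v (snd u + snd h) - b = A *v snd u - b + A *v snd h"
        by (simp add: matrix_vector_right_distrib)
      then show ?thesis
        using f[of "fst u" "snd u"] f[of "fst u + fst h" "snd u + snd h"]
          dot_lmul_matrix[of "A *v snd h" A "snd h"] dot_lmul_matrix[of "A *v snd u" A "snd h"]
          dot_lmul_matrix[of b A "snd h"]
        by (cases u; cases h) (simp add: T_def power2_norm_eq_inner * inner_simps dot_lmul_matrix
          inner_commute algebra_simps)
    qed
    moreover have "\<kappa> \<le> L" if "eigenvalue_of (hessian f 0) \<kappa>" for \<kappa> using ev[OF that] by simp
    ultimately show "f w \<le> f x + gradient f x \<bullet> (w - x) + L / 2 * (norm (w - x))\<^sup>2" for w x
      by (rule quadratic_descent)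
    show "ereal 0 \<le> ?G w" for w
      using J_nonneg J_le by (metis order_trans prod.collapse zero_ereal_def)
    show "level_bounded ?G" using coer by (rule coercive_imp_level_bounded)
    show "\<gamma> > 0" "L * \<gamma> < 1" using \<gamma> \<open>L > 0\<close> by (auto simp: field_simps)
  qed
  with coer show ?thesis by blast
qed

end
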